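(* Let $\phi$ be an instance of monotone 1-in-3 SAT with variables $x_1,\dots,x_n$ and clauses $C_1,\dots,C_m$, and let $G=(A\cup P,E)$ be the instance constructed from $\phi$ as described in the context. Then $G$ has a feasible matching of signature $(3m+n,\,3m+n)$ if and only if $\phi$ has a satisfying 1-in-3 assignment (an assignment making exactly one variable of each clause true).
   Context: Monotone 1-in-3 SAT: each clause is a disjunction of exactly three distinct unnegated variables. Construction of $G$: applicants $A=\{a_i,b_i: 1\le i\le n\}\cup\{a_{ij},b_{ij}: x_i\in C_j\}$; posts $P=\{p_i,p^t_i,p^f_i:1\le i\le n\}\cup\{p_j: 1\le j\le m\}$ (the clause posts $p_j$ are distinct from the variable posts $p_i$). Strict preference lists (first entry rank 1, second rank 2): $a_i: p_i, p^t_i$; $b_i: p_i, p^f_i$; $a_{ij}: p_j, p^t_i$; $b_{ij}: p_j,p^f_i$. Every applicant has quota 1 and no classification. For a clause $C_j=x_i\vee x_{i'}\vee x_{i''}$, post $p_j$ has quota 3 and classes $S_{ij}=\{a_{ij},b_{ij}\}$ with quota 1 for each variable $x_i$ of $C_j$, $S_{1j}=\{a_{ij},a_{i'j},a_{i''j}\}$ with quota 1, and $S_{2j}=\{b_{ij},b_{i'j},b_{i''j}\}$ with quota 2. Letting $k_i$ be the number of occurrences of $x_i$ in $\phi$: post $p^t_i$ has quota $k_i$ and classes $\{a_{ij},a_i\}$ with quota 1 for each $j$ with $x_i\in C_j$; post $p^f_i$ has quota $k_i$ and classes $\{b_{ij},b_i\}$ with quota 1 for each $j$ with $x_i\in C_j$;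 post $p_i$ has quota 1 and no classes. A matching $M\subseteq E$ is feasible if every vertex $u$ has $|M(u)|\le q(u)$ and $|M(u)\cap C|\le q(C)$ for each class $C$ of $u$. The signature of $M$ is $(x_1,x_2)$ where $x_k$ is the number of rank-$k$ edges in $M$.
   Formalization: Every variable x_1,…,x_n is required to occur in at least one clause; otherwise k_i = 0 leaves a_i and b_i competing for the single place at p_i and the claim fails for satisfiable φ. *)

theory Defs
  imports Main
begin

text \<open>A class of a vertex is stored together with its quota, as a pair.\<close>

record ('a, 'p) classified_instance =
  applicants :: "'a set"
  posts :: "'p set"
  prefs :: "'a \<Rightarrow> 'p list"
  quota_applicant :: "'a \<Rightarrow> nat"
  classes_applicant :: "'a \<Rightarrow> ('p set \<times> nat) set"
  quota_post :: "'p \<Rightarrow> nat"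
  classes_post :: "'p \<Rightarrow> ('a set \<times> nat) set"

definition edges :: "('a, 'p) classified_instance \<Rightarrow> ('a \<times> 'p) set" where
  "edges G = {(a, p). a \<in> applicants G \<and> p \<in> posts G \<and> p \<in> set (prefs G a)}"

text \<open>Positions in a preference list count from 1.\<close>

definition edge_rank :: "('a, 'p) classified_instance \<Rightarrow> 'a \<times> 'p \<Rightarrow> nat" where
  "edge_rank G e = Suc (LEAST k. k < length (prefs G (fst e)) \<and> prefs G (fst e) ! k = snd e)"

definition posts_of :: "('a \<times> 'p) set \<Rightarrow> 'a \<Rightarrow> 'p set" where
  "posts_of M a = {p. (a, p) \<in> M}"

definition applicants_of :: "('a \<times> 'p) set \<Rightarrow> 'p \<Rightarrow> 'a set" where
  "applicants_of M p = {a. (a, p) \<in> M}"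

definition feasible_matching :: "('a, 'p) classified_instance \<Rightarrow> ('a \<times> 'p) set \<Rightarrow> bool" where
  "feasible_matching G M \<longleftrightarrow> M \<subseteq> edges G \<and>
     (\<forall>a \<in> applicants G. card (posts_of M a) \<le> quota_applicant G a \<and>
        (\<forall>(S, q) \<in> classes_applicant G a. card (posts_of M a \<inter> S) \<le> q)) \<and>
     (\<forall>p \<in> posts G. card (applicants_of M p) \<le> quota_post G p \<and>
        (\<forall>(S, q) \<in> classes_post G p. card (applicants_of M p \<inter> S) \<le> q))"

definition signature :: "('a, 'p) classified_instance \<Rightarrow> ('a \<times> 'p) set \<Rightarrow> nat \<times> nat" where
  "signature G M = (card {e \<in> M. edge_rank G e = 1}, card {e \<in> M. edge_rank G e = 2})"

text \<open>
  A monotone formula with clauses \<open>C 1, \<dots>, C m\<close> is given by the sets of indices of the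
  variables in the clauses. Repeated clauses are allowed.
\<close>

definition monotone_1in3_sat :: "nat \<Rightarrow> (nat \<Rightarrow> nat set) \<Rightarrow> bool" where
  "monotone_1in3_sat m C \<longleftrightarrow> (\<forall>j \<in> {1..m}. card (C j) = 3)"

definition formula_vars :: "nat \<Rightarrow> (nat \<Rightarrow> nat set) \<Rightarrow> nat set" where
  "formula_vars m C = (\<Union>j \<in> {1..m}. C j)"

definition satisfies_1in3 :: "nat \<Rightarrow> (nat \<Rightarrow> nat set) \<Rightarrow> (nat \<Rightarrow> bool) \<Rightarrow> bool" where
  "satisfies_1in3 m C \<tau> \<longleftrightarrow> (\<forall>j \<in> {1..m}. \<exists>!i. i \<in> C j \<and> \<tau> i)"

definition occurrences :: "nat \<Rightarrow> (nat \<Rightarrow> nat set) \<Rightarrow> nat \<Rightarrow> nat" where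
  "occurrences m C i = card {j \<in> {1..m}. i \<in> C j}"

text \<open>
  \<open>VarA i\<close>, \<open>VarB i\<close> are $a_i$, $b_i$; \<open>OccA i j\<close>, \<open>OccB i j\<close> are $a_{ij}$, $b_{ij}$.
  \<open>PVar i\<close>, \<open>PTrue i\<close>, \<open>PFalse i\<close> are $p_i$, $p^t_i$, $p^f_i$; \<open>PClause j\<close> is the clause
  post $p_j$.
\<close>

datatype applicant = VarA nat | VarB nat | OccA nat nat | OccB nat nat

datatype post = PVar nat | PTrue nat | PFalse nat | PClause nat

fun red_prefs :: "applicant \<Rightarrow> post list" where
  "red_prefs (VarA i) = [PVar i, PTrue i]"
| "red_prefs (VarB i) = [PVar i, PFalse i]"
| "red_prefs (OccA i j) = [PClause j, PTrue i]"
| "red_prefs (OccB i j) = [PClause j, PFalse i]"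

fun red_quota :: "nat \<Rightarrow> (nat \<Rightarrow> nat set) \<Rightarrow> post \<Rightarrow> nat" where
  "red_quota m C (PVar i) = 1"
| "red_quota m C (PTrue i) = occurrences m C i"
| "red_quota m C (PFalse i) = occurrences m C i"
| "red_quota m C (PClause j) = 3"

fun red_classes :: "nat \<Rightarrow> (nat \<Rightarrow> nat set) \<Rightarrow> post \<Rightarrow> (applicant set \<times> nat) set" where
  "red_classes m C (PVar i) = {}"
| "red_classes m C (PTrue i) = {({OccA i j, VarA i}, 1) | j. j \<in> {1..m} \<and> i \<in> C j}"
| "red_classes m C (PFalse i) = {({OccB i j, VarB i}, 1) | j. j \<in> {1..m} \<and> i \<in> C j}"
| "red_classes m C (PClause j) =
     {({OccA i j, OccB i j}, 1) | i. i \<in> C j} \<union>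
     {((\<lambda>i. OccA i j) ` C j, 1), ((\<lambda>i. OccB i j) ` C j, 2)}"

definition reduction ::
  "nat \<Rightarrow> nat \<Rightarrow> (nat \<Rightarrow> nat set) \<Rightarrow> (applicant, post) classified_instance" where
  "reduction n m C =
    \<lparr> applicants = VarA ` {1..n} \<union> VarB ` {1..n} \<union>
        {OccA i j | i j. i \<in> {1..n} \<and> j \<in> {1..m} \<and> i \<in> C j} \<union>
        {OccB i j | i j. i \<in> {1..n} \<and> j \<in> {1..m} \<and> i \<in> C j},
      posts = PVar ` {1..n} \<union> PTrue ` {1..n} \<union> PFalse ` {1..n} \<union> PClause ` {1..m},
      prefs = red_prefs,
      quota_applicant = (\<lambda>_. 1),
      classes_applicant = (\<lambda>_. {}),
      quota_post = red_quota m C,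
      classes_post = red_classes m C \<rparr>"

end

theory Submission
  imports Defs
begin

text \<open>
  There are \<open>2 (3 m + n)\<close> applicants, each of quota 1, so a matching of the required signature
  matches every applicant. Call \<open>x\<^sub>i\<close> true if \<open>a\<^sub>i\<close> is matched to its
  second choice. Then the classes of \<open>p\<^sup>t\<^sub>i\<close> push all \<open>a\<^sub>i\<^sub>j\<close> to the clause posts;
  if \<open>x\<^sub>i\<close> is false, then \<open>a\<^sub>i\<close> occupies \<open>p\<^sub>i\<close>, hence \<open>b\<^sub>i\<close> is at
  \<open>p\<^sup>f\<^sub>i\<close> and all \<open>b\<^sub>i\<^sub>j\<close> are pushed to the clause posts. The quotas 1 and 2 of the
  last two classes of a clause post then leave room for at most one true and at most two false
  variables in each clause. Conversely, an assignment prescribes in the same way which applicants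
  get their first choice.
\<close>

section \<open>The matching prescribed by an assignment, and its ranks\<close>

text \<open>A true variable gives \<open>VarB i\<close> and all its \<open>OccA i j\<close> their
  first choice, so that \<open>PTrue i\<close> stays free for \<open>VarA i\<close>; a false one
  swaps the roles of A and B. Indexing occurrences by clause first turns them into a
  \<open>SIGMA\<close> with three pairs per clause.\<close>

definition first_choice_applicants ::
  "nat \<Rightarrow> nat \<Rightarrow> (nat \<Rightarrow> nat set) \<Rightarrow> (nat \<Rightarrow> bool) \<Rightarrow> applicant set" where
  "first_choice_applicants n m C \<tau> =
     (\<lambda>i. if \<tau> i then VarB i else VarA i) ` {1..n} \<union>
     (\<lambda>(j, i). if \<tau> i then OccA i j else OccB i j) ` (SIGMA j:{1..m}. C j)"

text \<open>The applicants left to their second choice are those getting their first choice under the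
  complementary assignment.\<close>

definition assignment_matching ::
  "nat \<Rightarrow> nat \<Rightarrow> (nat \<Rightarrow> nat set) \<Rightarrow> (nat \<Rightarrow> bool) \<Rightarrow> (applicant \<times> post) set" where
  "assignment_matching n m C \<tau> =
     (\<lambda>a. (a, red_prefs a ! 0)) ` first_choice_applicants n m C \<tau> \<union>
     (\<lambda>a. (a, red_prefs a ! 1)) ` first_choice_applicants n m C (\<lambda>i. \<not> \<tau> i)"

lemma edge_rank_first: "edge_rank (reduction n m C) (a, red_prefs a ! 0) = 1"
  by (cases a) (auto simp: edge_rank_def reduction_def intro!: Least_equality)

text \<open>The two posts of a list come from different constructors, so position 0 does not carry
  the second post and the least position is 1.\<close>

lemma edge_rank_second: "edge_rank (reduction n m C) (a, red_prefs a ! 1) = 2"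
proof -
  have "(LEAST k. k < length (red_prefs a) \<and> red_prefs a ! k = red_prefs a ! 1) = 1"
  proof (rule Least_equality)
    show "1 < length (red_prefs a) \<and> red_prefs a ! 1 = red_prefs a ! 1" by (cases a) auto
  next
    fix k assume "k < length (red_prefs a) \<and> red_prefs a ! k = red_prefs a ! 1"
    then show "1 \<le> k" by (cases a; cases k) auto
  qed
  then show ?thesis by (simp add: edge_rank_def reduction_def)
qed

lemma first_choice_applicants_iff:
  "VarA i \<in> first_choice_applicants n m C \<tau> \<longleftrightarrow> i \<in> {1..n} \<and> \<not> \<tau> i"
  "VarB i \<in> first_choice_applicants n m C \<tau> \<longleftrightarrow> i \<in> {1..n} \<and> \<tau> i"
  "OccA i j \<in> first_choice_applicants n m C \<tau> \<longleftrightarrow> j \<in> {1..m} \<and> i \<in> C j \<and> \<tau> i"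
  "OccB i j \<in> first_choice_applicants n m C \<tau> \<longleftrightarrow> j \<in> {1..m} \<and> i \<in> C j \<and> \<not> \<tau> i"
  by (force simp: first_choice_applicants_def split: if_splits)+

section \<open>Counting applicants and edges\<close>

locale monotone_instance =
  fixes n m :: nat and C :: "nat \<Rightarrow> nat set"
  assumes monotone: "monotone_1in3_sat m C"
    and vars: "formula_vars m C = {1..n}"
begin

abbreviation "G \<equiv> reduction n m C"

lemma card_clause: "j \<in> {1..m} \<Longrightarrow> card (C j) = 3"
  using monotone by (simp add: monotone_1in3_sat_def)

text \<open>An infinite set has \<open>card\<close> 0, not 3.\<close>

lemma finite_clause: "j \<in> {1..m} \<Longrightarrow> finite (C j)"
  using card_clause[of j] by (metis card.infinite zero_neq_numeral)

lemma clause_vars: "j \<in> {1..m} \<Longrightarrow> i \<in> C j \<Longrightarrow> i \<in> {1..n}"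
  using vars by (auto simp: formula_vars_def)

text \<open>The equation \<open>vars\<close> makes every variable occur in some clause. Hence
  \<open>PTrue i\<close> and \<open>PFalse i\<close> always have room for \<open>VarA i\<close> and
  \<open>VarB i\<close>.\<close>

lemma occurrences_pos:
  assumes "i \<in> {1..n}" shows "occurrences m C i \<ge> 1"
proof -
  obtain j where "j \<in> {1..m}" "i \<in> C j"
    using vars assms unfolding formula_vars_def by blast
  then have "{j \<in> {1..m}. i \<in> C j} \<noteq> {}" by blast
  then show ?thesis
    unfolding occurrences_def by (simp add: Suc_le_eq card_gt_0_iff)
qed

lemma finite_first_choice_applicants: "finite (first_choice_applicants n m C \<tau>)"
  unfolding first_choice_applicants_def using finite_clause
  by (intro finite_UnI finite_imageI finite_SigmaI) auto

lemma card_first_choice_applicants: "card (first_choice_applicants n m C \<tau>) = 3 * m + n"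
proof -
  let ?V = "(\<lambda>i. if \<tau> i then VarB i else VarA i) ` {1..n}"
  let ?O = "(\<lambda>(j, i). if \<tau> i then OccA i j else OccB i j) ` (SIGMA j:{1..m}. C j)"
  have V: "card ?V = n"
    by (subst card_image) (auto simp: inj_on_def split: if_splits)
  have "card ?O = card (SIGMA j:{1..m}. C j)"
    by (rule card_image) (auto simp: inj_on_def split: if_splits)
  also have "\<dots> = (\<Sum>j\<in>{1..m}. card (C j))"
    by (rule card_SigmaI) (use finite_clause in auto)
  also have "\<dots> = 3 * m" using card_clause by simp
  finally have O: "card ?O = 3 * m" .
  have "finite ?O" using finite_clause by (intro finite_imageI finite_SigmaI) auto
  moreover have "?V \<inter> ?O = {}" by (auto split: if_splits)
  ultimately show ?thesis
    unfolding first_choice_applicants_def using V O by (subst card_Un_disjoint) auto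
qed

text \<open>An assignment picks one applicant from each pair \<open>VarA i\<close>,
  \<open>VarB i\<close> and from each pair \<open>OccA i j\<close>, \<open>OccB i j\<close>; its
  complement picks the other one.\<close>

lemma applicants_split:
  "applicants G = first_choice_applicants n m C \<tau> \<union> first_choice_applicants n m C (\<lambda>i. \<not> \<tau> i)"
proof (rule set_eqI)
  fix a
  show "a \<in> applicants G \<longleftrightarrow>
      a \<in> first_choice_applicants n m C \<tau> \<union> first_choice_applicants n m C (\<lambda>i. \<not> \<tau> i)"
    using clause_vars by (cases a) (auto simp: first_choice_applicants_iff reduction_def)
qed

lemma first_choice_applicants_disjoint:
  "first_choice_applicants n m C \<tau> \<inter> first_choice_applicants n m C (\<lambda>i. \<not> \<tau> i) = {}"
  by (auto simp: first_choice_applicants_def split: if_splits)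

lemma card_applicants: "finite (applicants G)" "card (applicants G) = 2 * (3 * m + n)"
proof -
  \<comment> \<open>Any assignment serves for the count: both halves have size
    \<open>3 * m + n\<close>.\<close>
  note [simp] = applicants_split[of "\<lambda>_. True"] finite_first_choice_applicants
  show "finite (applicants G)" by simp
  show "card (applicants G) = 2 * (3 * m + n)"
    using first_choice_applicants_disjoint[of "\<lambda>_. True"]
    by (simp add: card_Un_disjoint card_first_choice_applicants)
qed

lemma finite_edges: "finite (edges G)"
proof (rule finite_subset)
  show "edges G \<subseteq> applicants G \<times> posts G" by (auto simp: edges_def)
  show "finite (applicants G \<times> posts G)"
    using card_applicants(1) by (simp add: reduction_def)
qed

section \<open>From a matching to an assignment\<close>

lemma all_applicants_matched:
  assumes feas: "feasible_matching G M"
    and sig: "signature G M = (3 * m + n, 3 * m + n)"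
    and a: "a \<in> applicants G"
  shows "(a, red_prefs a ! 0) \<in> M \<or> (a, red_prefs a ! 1) \<in> M"
proof -
  have sub: "M \<subseteq> edges G" using feas by (simp add: feasible_matching_def)
  have fin: "finite M" using sub finite_edges by (rule finite_subset)
  let ?R = "\<lambda>k. {e \<in> M. edge_rank G e = k}"
  \<comment> \<open>The edges of rank 1 and of rank 2 are disjoint, so the signature gives at least
    as many edges as there are applicants.\<close>
  have "card (?R 1 \<union> ?R 2) = card (?R 1) + card (?R 2)"
    using fin by (intro card_Un_disjoint) auto
  moreover have "card (?R 1 \<union> ?R 2) \<le> card M" using fin by (intro card_mono) auto
  ultimately have "2 * (3 * m + n) \<le> card M" using sig by (simp add: signature_def)
  moreover have "inj_on fst M"
  proof (rule inj_onI)
    fix x y assume xy: "x \<in> M" "y \<in> M" "fst x = fst y"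
    have "fst x \<in> applicants G" using sub xy(1) by (auto simp: edges_def)
    then have "card (posts_of M (fst x)) \<le> 1"
      using feas by (auto simp: feasible_matching_def reduction_def)
    \<comment> \<open>Finiteness rules out the default \<open>card\<close> 0 of an infinite set, so
      the bound 1 really means at most one post.\<close>
    moreover have "finite (posts_of M (fst x))"
      by (rule finite_subset[of _ "snd ` M"]) (use fin in \<open>auto simp: posts_of_def image_iff\<close>, force)
    moreover have "snd x \<in> posts_of M (fst x)" "snd y \<in> posts_of M (fst x)"
      using xy(1,2) unfolding posts_of_def mem_Collect_eq prod.collapse
      by (simp_all add: xy(3))
    ultimately have "snd x = snd y" by (simp add: card_le_Suc0_iff_eq)
    then show "x = y" using xy(3) by (simp add: prod_eq_iff)
  qed
  ultimately have "card (applicants G) \<le> card (fst ` M)"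
    by (simp add: card_image card_applicants)
  moreover have "fst ` M \<subseteq> applicants G" using sub by (auto simp: edges_def)
  \<comment> \<open>A subset of the finite set of applicants that is at least as large is all of
    it.\<close>
  ultimately have "fst ` M = applicants G" using card_applicants(1) by (intro card_seteq)
  then obtain p where p: "(a, p) \<in> M" using a by force
  then have "p \<in> set (red_prefs a)" using sub by (auto simp: edges_def reduction_def)
  then show ?thesis using p by (cases a) auto
qed

lemma class_quota:
  assumes "feasible_matching G M" "p \<in> posts G" "(S, q) \<in> red_classes m C p"
  shows "card (applicants_of M p \<inter> S) \<le> q"
proof -
  have "\<forall>(S, q) \<in> classes_post G p. card (applicants_of M p \<inter> S) \<le> q"
    using assms(1,2) by (auto simp: feasible_matching_def)
  then show ?thesis using assms(3) by (auto simp: reduction_def)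
qed

text \<open>A class of quota 1 cannot hold two distinct applicants. With applicants from different
  constructors the conclusion \<open>a = b\<close> is a contradiction, which is how the pushing
  steps use it.\<close>

lemma pair_class_exclusive:
  assumes "feasible_matching G M" "p \<in> posts G" "({a, b}, 1) \<in> red_classes m C p"
    and "(a, p) \<in> M" "(b, p) \<in> M"
  shows "a = b"
proof -
  have "applicants_of M p \<inter> {a, b} = {a, b}" using assms by (auto simp: applicants_of_def)
  then have "card {a, b} \<le> 1" using class_quota[OF assms(1-3)] by simp
  then show ?thesis by (cases "a = b") auto
qed

lemma satisfies_of_matching:
  assumes feas: "feasible_matching G M"
    and sig: "signature G M = (3 * m + n, 3 * m + n)"
  shows "satisfies_1in3 m C (\<lambda>i. (VarA i, PTrue i) \<in> M)"
proof -
  define \<tau> where "\<tau> i \<longleftrightarrow> (VarA i, PTrue i) \<in> M" for i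
  note matched = all_applicants_matched[OF feas sig]
  have sub: "M \<subseteq> edges G" using feas by (simp add: feasible_matching_def)
  have posts_in: "PVar i \<in> posts G" "PTrue i \<in> posts G" "PFalse i \<in> posts G" if "i \<in> {1..n}" for i
    using that by (auto simp: reduction_def)
  have occ_in: "OccA i j \<in> applicants G" "OccB i j \<in> applicants G"
    if "j \<in> {1..m}" "i \<in> C j" for i j
    using that clause_vars[OF that] by (auto simp: reduction_def)
  have pushA: "(OccA i j, PClause j) \<in> M" if ij: "j \<in> {1..m}" "i \<in> C j" and "\<tau> i" for i j
  proof (rule ccontr)
    assume "(OccA i j, PClause j) \<notin> M"
    then have "(OccA i j, PTrue i) \<in> M" using matched[OF occ_in(1)[OF ij]] by simp
    moreover have "({OccA i j, VarA i}, 1) \<in> red_classes m C (PTrue i)" using ij by auto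
    ultimately show False
      using pair_class_exclusive[OF feas posts_in(2)[OF clause_vars[OF ij]]] \<open>\<tau> i\<close>
      unfolding \<tau>_def by blast
  qed
  have VarB: "(VarB i, PFalse i) \<in> M" if i: "i \<in> {1..n}" and "\<not> \<tau> i" for i
  proof (rule ccontr)
    assume "(VarB i, PFalse i) \<notin> M"
    moreover have "VarA i \<in> applicants G" "VarB i \<in> applicants G"
      using i by (auto simp: reduction_def)
    ultimately have "(VarA i, PVar i) \<in> M" "(VarB i, PVar i) \<in> M"
      using matched[of "VarA i"] matched[of "VarB i"] \<open>\<not> \<tau> i\<close> by (auto simp: \<tau>_def)
    \<comment> \<open>Both variable applicants would now share \<open>PVar i\<close>, whose quota is
      1.\<close>
    then have "{VarA i, VarB i} \<subseteq> applicants_of M (PVar i)" by (auto simp: applicants_of_def)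
    moreover have "finite (applicants_of M (PVar i))"
      by (rule finite_subset[OF _ card_applicants(1)])
        (use sub in \<open>auto simp: applicants_of_def edges_def\<close>)
    ultimately have "card {VarA i, VarB i} \<le> card (applicants_of M (PVar i))"
      by (rule card_mono[rotated])
    moreover have "card (applicants_of M (PVar i)) \<le> quota_post G (PVar i)"
      using feas posts_in(1)[OF i] by (auto simp: feasible_matching_def)
    ultimately show False by (simp add: reduction_def)
  qed
  have pushB: "(OccB i j, PClause j) \<in> M" if ij: "j \<in> {1..m}" "i \<in> C j" and "\<not> \<tau> i" for i j
  proof (rule ccontr)
    assume "(OccB i j, PClause j) \<notin> M"
    then have "(OccB i j, PFalse i) \<in> M" using matched[OF occ_in(2)[OF ij]] by simp
    moreover have "({OccB i j, VarB i}, 1) \<in> red_classes m C (PFalse i)" using ij by auto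
    ultimately show False
      using pair_class_exclusive[OF feas posts_in(3)[OF clause_vars[OF ij]]]
        VarB[OF clause_vars[OF ij] \<open>\<not> \<tau> i\<close>] by blast
  qed
  have "\<exists>!i. i \<in> C j \<and> \<tau> i" if j: "j \<in> {1..m}" for j
  proof -
    have pj: "PClause j \<in> posts G" using j by (auto simp: reduction_def)
    let ?T = "{i \<in> C j. \<tau> i}" and ?F = "{i \<in> C j. \<not> \<tau> i}"
    note fin = finite_clause[OF j]
    \<comment> \<open>True variables inject into the class of quota 1 through their
      \<open>OccA\<close> copies; below, false ones inject into the class of quota 2 through their
      \<open>OccB\<close> copies.\<close>
    have "card ?T = card ((\<lambda>i. OccA i j) ` ?T)"
      by (rule card_image[symmetric]) (auto simp: inj_on_def)
    also have "\<dots> \<le> card (applicants_of M (PClause j) \<inter> (\<lambda>i. OccA i j) ` C j)"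
      using fin pushA[OF j] by (intro card_mono) (auto simp: applicants_of_def)
    also have "\<dots> \<le> 1" by (rule class_quota[OF feas pj]) simp
    finally have T: "card ?T \<le> 1" .
    have "card ?F = card ((\<lambda>i. OccB i j) ` ?F)"
      by (rule card_image[symmetric]) (auto simp: inj_on_def)
    also have "\<dots> \<le> card (applicants_of M (PClause j) \<inter> (\<lambda>i. OccB i j) ` C j)"
      using fin pushB[OF j] by (intro card_mono) (auto simp: applicants_of_def)
    also have "\<dots> \<le> 2" by (rule class_quota[OF feas pj]) simp
    finally have "card ?F \<le> 2" .
    \<comment> \<open>Three variables with at most two false leave at least one true, and
      \<open>T\<close> allows no more.\<close>
    moreover have "card (?T \<union> ?F) = card ?T + card ?F"
      using fin by (intro card_Un_disjoint) auto
    moreover have "?T \<union> ?F = C j" by auto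
    ultimately have "card ?T = 1" using T card_clause[OF j] by simp
    then obtain i where "?T = {i}" by (rule card_1_singletonE)
    then have "x \<in> C j \<and> \<tau> x \<longleftrightarrow> x = i" for x by auto
    then show ?thesis by simp
  qed
  then show ?thesis unfolding satisfies_1in3_def \<tau>_def by blast
qed

section \<open>From an assignment to a matching\<close>

lemma signature_assignment_matching:
  "signature G (assignment_matching n m C \<tau>) = (3 * m + n, 3 * m + n)"
proof -
  let ?M = "assignment_matching n m C \<tau>"
  have "{e \<in> ?M. edge_rank G e = 1} =
      (\<lambda>a. (a, red_prefs a ! 0)) ` first_choice_applicants n m C \<tau>"
    using edge_rank_first[of n m C] edge_rank_second[of n m C]
    by (auto simp: assignment_matching_def)
  moreover have "{e \<in> ?M. edge_rank G e = 2} =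
      (\<lambda>a. (a, red_prefs a ! 1)) ` first_choice_applicants n m C (\<lambda>i. \<not> \<tau> i)"
    using edge_rank_first[of n m C] edge_rank_second[of n m C]
    by (auto simp: assignment_matching_def)
  ultimately show ?thesis
    by (simp add: signature_def card_image inj_on_def card_first_choice_applicants)
qed

text \<open>No applicant lies in both halves of the matching.\<close>

lemma posts_of_assignment_matching:
  "\<exists>p. posts_of (assignment_matching n m C \<tau>) a \<subseteq> {p}"
  using first_choice_applicants_disjoint[of \<tau>]
  unfolding posts_of_def assignment_matching_def by blast

text \<open>Upper bounds on the load of each post; inclusions suffice because quotas only bound from
  above.\<close>

lemma applicants_of_assignment_matching:
  "applicants_of (assignment_matching n m C \<tau>) (PVar i) \<subseteq> {if \<tau> i then VarB i else VarA i}"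
  "applicants_of (assignment_matching n m C \<tau>) (PTrue i) \<subseteq>
     (if \<tau> i then {VarA i} else (\<lambda>j. OccA i j) ` {j \<in> {1..m}. i \<in> C j})"
  "applicants_of (assignment_matching n m C \<tau>) (PFalse i) \<subseteq>
     (if \<tau> i then (\<lambda>j. OccB i j) ` {j \<in> {1..m}. i \<in> C j} else {VarB i})"
  "applicants_of (assignment_matching n m C \<tau>) (PClause j) \<subseteq>
     (\<lambda>i. if \<tau> i then OccA i j else OccB i j) ` C j"
  by (auto simp: applicants_of_def assignment_matching_def first_choice_applicants_def
      split: if_splits)

lemma assignment_matching_subset_edges: "assignment_matching n m C \<tau> \<subseteq> edges G"
proof -
  have "(a, red_prefs a ! k) \<in> edges G" if "a \<in> applicants G" "k < 2" for a k
    using that clause_vars by (cases a) (auto simp: edges_def reduction_def less_2_cases_iff)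
  then show ?thesis
    using applicants_split[of \<tau>] by (auto simp: assignment_matching_def)
qed

lemma feasible_assignment_matching:
  assumes sat: "satisfies_1in3 m C \<tau>"
  shows "feasible_matching G (assignment_matching n m C \<tau>)"
proof -
  let ?M = "assignment_matching n m C \<tau>"
  note sub = applicants_of_assignment_matching[of \<tau>]
  have card_le: "card X \<le> card Y" if "X \<subseteq> Y" "finite Y" for X Y :: "applicant set"
    using that by (rule card_mono[rotated])
  have single: "card X \<le> 1" if "X \<subseteq> {y}" for X and y :: applicant
    using card_le[OF that] by simp
  have applicant: "card (posts_of ?M a) \<le> 1" for a
  proof -
    obtain p where "posts_of ?M a \<subseteq> {p}" using posts_of_assignment_matching by blast
    then have "card (posts_of ?M a) \<le> card {p}" by (intro card_mono) auto
    then show ?thesis by simp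
  qed
  have occ: "card (f ` {j \<in> {1..m}. i \<in> C j}) \<le> occurrences m C i"
    for f :: "nat \<Rightarrow> applicant" and i
    unfolding occurrences_def by (rule card_image_le) simp
  have quota: "card (applicants_of ?M p) \<le> red_quota m C p" if p: "p \<in> posts G" for p
  proof (cases p)
    case (PVar i)
    then show ?thesis using single[OF sub(1)] by simp
  next
    case (PTrue i)
    then have "i \<in> {1..n}" using p by (auto simp: reduction_def)
    note pos = occurrences_pos[OF this]
    show ?thesis
    proof (cases "\<tau> i")
      case True
      \<comment> \<open>Only \<open>VarA i\<close> can be here, and the quota is at least 1.\<close>
      then have "card (applicants_of ?M (PTrue i)) \<le> 1"
        using sub(2)[of i] by (intro single[of _ "VarA i"]) simp
      then show ?thesis using pos PTrue by simp
    next
      case False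
      \<comment> \<open>The second-choice \<open>OccA i j\<close> come at most once per occurrence
        of the variable, which is the quota.\<close>
      then have "card (applicants_of ?M (PTrue i)) \<le> card (OccA i ` {j \<in> {1..m}. i \<in> C j})"
        using sub(2)[of i] by (intro card_le) simp_all
      then show ?thesis using occ[of "OccA i" i] PTrue by simp
    qed
  next
    case (PFalse i)
    then have "i \<in> {1..n}" using p by (auto simp: reduction_def)
    note pos = occurrences_pos[OF this]
    show ?thesis
    proof (cases "\<tau> i")
      case False
      then have "card (applicants_of ?M (PFalse i)) \<le> 1"
        using sub(3)[of i] by (intro single[of _ "VarB i"]) simp
      then show ?thesis using pos PFalse by simp
    next
      case True
      then have "card (applicants_of ?M (PFalse i)) \<le> card (OccB i ` {j \<in> {1..m}. i \<in> C j})"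
        using sub(3)[of i] by (intro card_le) simp_all
      then show ?thesis using occ[of "OccB i" i] PFalse by simp
    qed
  next
    case (PClause j)
    then have j: "j \<in> {1..m}" using p by (auto simp: reduction_def)
    have "card (applicants_of ?M p) \<le> card ((\<lambda>i. if \<tau> i then OccA i j else OccB i j) ` C j)"
      using PClause sub(4)[of j] finite_clause[OF j] by (intro card_le) auto
    also have "\<dots> \<le> card (C j)" using finite_clause[OF j] by (rule card_image_le)
    finally show ?thesis using card_clause[OF j] PClause by simp
  qed
  have class_ok: "card (applicants_of ?M p \<inter> S) \<le> q"
    if p: "p \<in> posts G" and S: "(S, q) \<in> red_classes m C p" for p S q
  proof (cases p)
    case (PVar i)
    then show ?thesis using S by simp
  next
    case (PTrue i)
    then obtain j where "S = {OccA i j, VarA i}" "q = 1" using S by auto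
    \<comment> \<open>\<open>VarA i\<close> and the \<open>OccA i j\<close> never meet at this post:
      the value of the variable decides which kind may come.\<close>
    moreover have "applicants_of ?M p \<inter> {OccA i j, VarA i} \<subseteq> {if \<tau> i then VarA i else OccA i j}"
      using sub(2)[of i] PTrue by (auto split: if_splits)
    ultimately show ?thesis using single by blast
  next
    case (PFalse i)
    then obtain j where "S = {OccB i j, VarB i}" "q = 1" using S by auto
    moreover have "applicants_of ?M p \<inter> {OccB i j, VarB i} \<subseteq> {if \<tau> i then OccB i j else VarB i}"
      using sub(3)[of i] PFalse by (auto split: if_splits)
    ultimately show ?thesis using single by blast
  next
    case (PClause j)
    then have j: "j \<in> {1..m}" using p by (auto simp: reduction_def)
    \<comment> \<open>The 1-in-3 condition supplies the unique true variable \<open>t\<close> of the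
      clause, which settles the classes of quota 1 and 2 across the clause.\<close>
    then obtain t where t: "t \<in> C j" "\<tau> t" and uniq: "\<And>i. i \<in> C j \<Longrightarrow> \<tau> i \<Longrightarrow> i = t"
      using sat unfolding satisfies_1in3_def by blast
    consider (occ) i where "S = {OccA i j, OccB i j}" "q = 1"
      | (A) "S = (\<lambda>i. OccA i j) ` C j" "q = 1" | (B) "S = (\<lambda>i. OccB i j) ` C j" "q = 2"
      using S PClause by auto
    then show ?thesis
    proof cases
      case occ
      have "applicants_of ?M p \<inter> S \<subseteq> {if \<tau> i then OccA i j else OccB i j}"
        using sub(4)[of j] PClause occ by (auto split: if_splits)
      then show ?thesis using single occ by blast
    next
      case A
      have "applicants_of ?M p \<inter> S \<subseteq> {OccA t j}"
        using sub(4)[of j] PClause A uniq by (auto split: if_splits)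
      then show ?thesis using single A by blast
    next
      case B
      \<comment> \<open>The true variable sends its \<open>OccA\<close> copy to this post, so at
        most the two \<open>OccB\<close> copies of the other variables remain.\<close>
      have "applicants_of ?M p \<inter> S \<subseteq> (\<lambda>i. OccB i j) ` (C j - {t})"
        using sub(4)[of j] PClause B t by (auto split: if_splits)
      then have "card (applicants_of ?M p \<inter> S) \<le> card ((\<lambda>i. OccB i j) ` (C j - {t}))"
        using finite_clause[OF j] by (intro card_le) auto
      also have "\<dots> \<le> card (C j - {t})" using finite_clause[OF j] by (intro card_image_le) auto
      also have "\<dots> = 2" using card_clause[OF j] finite_clause[OF j] t by simp
      finally show ?thesis using B by simp
    qed
  qed
  show ?thesis
    unfolding feasible_matching_def
    using assignment_matching_subset_edges applicant quota class_ok
    by (auto simp: reduction_def)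
qed

end

theorem theorem5:
  fixes n m :: nat and C :: "nat \<Rightarrow> nat set"
  assumes "monotone_1in3_sat m C"
    and "formula_vars m C = {1..n}"
  shows "(\<exists>M. feasible_matching (reduction n m C) M \<and>
            signature (reduction n m C) M = (3 * m + n, 3 * m + n))
         \<longleftrightarrow> (\<exists>\<tau>. satisfies_1in3 m C \<tau>)"
proof -
  interpret monotone_instance n m C using assms by unfold_locales
  show ?thesis
    using satisfies_of_matching feasible_assignment_matching signature_assignment_matching
    by blast
qed

end
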